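(* For all integers $h \geq 2$, $m \geq h$, $0 \leq x \leq h$, and $n \geq 0$, whenever $\lambda_m(x) \in \mathbb{Z}$ and $h \mid \lambda_m(x)$, we have $$\binom{x}{n} \equiv \sum_{i=1}^{n} \binom{x-m+i}{i}\binom{x}{n-i}\cdot\frac{m!}{(m-i)!}\cdot\frac{(2m-1-i)!}{(2m-1)!}(-1)^{i+1} + \binom{x+m}{n}\binom{m-1}{n}\binom{2m-1}{n}^{-1}[0\leq n<m] \pmod{h}.$$
   Context: $\binom{y}{k} = y(y-1)\cdots(y-k+1)/k!$ for integers $k\ge 0$ and arbitrary (possibly negative) $y$. For integers $h\ge 2$, $$\lambda_h(x) := \prod_{i=2}^{h}\mathrm{ab}_{x,i},\qquad \mathrm{ab}_{x,2} := -\tfrac12 x(x+1),\qquad \mathrm{ab}_{x,i} := -\frac{1}{4(2i-3)^2}(x-i+2)(x+i-1)\ \ (i\ge 3),$$ equivalently $$\lambda_h(x) = \frac{(-1)^{h-1}}{2}\binom{x+h-1}{h-1}\binom{x}{h-1}\binom{2h-3}{h-2}^{-2}.$$ Conventions: $[0\le n<m]$ equals $1$ if $0\le n<m$ and $0$ otherwise, and the term containing it is $0$ when the condition fails; summands with $i>m$ are $0$ (since $1/(m-i)!$ is read as $0$). The right-hand side is a priori a rational number; for rational numbers $a,b$, $a\equiv b \pmod h$ means $(a-b)/h\in\mathbb{Z}$. *)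

theory Defs
  imports Complex_Main
begin

text \<open>Only indices \<open>i \<ge> 2\<close> are meaningful.\<close>

definition ab :: "rat \<Rightarrow> nat \<Rightarrow> rat" where
  "ab x i =
    (if i = 2 then - (1 / 2) * x * (x + 1)
     else - (1 / (4 * (2 * of_nat i - 3)\<^sup>2)) * (x - of_nat i + 2) * (x + of_nat i - 1))"

definition lam :: "nat \<Rightarrow> rat \<Rightarrow> rat" where
  "lam h x = (\<Prod>i = 2..h. ab x i)"

text \<open>
  Congruence of arbitrary rationals modulo the subgroup \<open>h \<int>\<close>; the denominators of \<open>a\<close> and \<open>b\<close>
  are not required to be coprime to \<open>h\<close>.
\<close>

definition rat_cong :: "rat \<Rightarrow> rat \<Rightarrow> nat \<Rightarrow> bool" where
  "rat_cong a b h \<longleftrightarrow> (a - b) / of_nat h \<in> \<int>"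

end

theory Submission
  imports Defs
begin

text \<open>
  The congruence is an equality in the range \<open>0 \<le> x < m\<close>. Moving the binomial coefficient on the left
  into the sum as the term \<open>i = 0\<close>, and writing \<open>(-1)^i\<close> times \<open>x - m + i\<close> over \<open>i\<close> as
  \<open>m - 1 - x\<close> over \<open>i\<close>, turns the claim into
  \[ \sum_{i=0}^{n} \binom{m-1-x}{i}\binom{x}{n-i}\binom{m}{i}\binom{2m-1}{i}^{-1}
     = \binom{x+m}{n}\binom{m-1}{n}\binom{2m-1}{n}^{-1}. \]
  The left side is a terminating hypergeometric series of type 3F2 at 1, and because
  \<open>(m - 1 - x) + x + m = 2 m - 1\<close> it is balanced. So for \<open>n < m\<close> it is evaluated by the
  Pfaff--Saalschuetz theorem, proved below in a denominator-free form
  (\<open>pfaff_saalschuetz\<close>) that holds in every commutative ring. For \<open>n \<ge> m\<close> all terms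
  vanish, since \<open>i \<le> m - 1 - x\<close> and \<open>n - i \<le> x\<close> would add up to \<open>n \<le> m - 1\<close>.

  As \<open>x \<le> h \<le> m\<close>, what remains is \<open>x = h = m\<close>, and here the hypotheses on \<open>lam\<close> are
  contradictory. The closed form of \<open>lam\<close> shows that \<open>lam m m\<close> times the integer
  \<open>2 m - 3\<close> over \<open>m - 2\<close> is \<open>\<plusminus> (2 m - 1)\<close>. If \<open>lam m m\<close> were an integer divisible by \<open>m\<close>,
  then \<open>m\<close> would divide \<open>2 m - 1\<close>, hence 1.
\<close>

section \<open>The Pfaff--Saalschuetz identity\<close>

lemma sum_binomial_Suc:
  fixes f :: "nat \<Rightarrow> 'a::comm_ring_1"
  shows "(\<Sum>i\<le>Suc n. of_nat (Suc n choose i) * f i) = (\<Sum>i\<le>n. of_nat (n choose i) * (f i + f (Suc i)))"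
proof -
  have "(\<Sum>i\<le>Suc n. of_nat (Suc n choose i) * f i)
      = f 0 + (\<Sum>i\<le>n. of_nat (Suc n choose Suc i) * f (Suc i))"
    by (subst sum.atMost_Suc_shift) simp
  also have "\<dots> = (f 0 + (\<Sum>i\<le>n. of_nat (n choose Suc i) * f (Suc i)))
                  + (\<Sum>i\<le>n. of_nat (n choose i) * f (Suc i))"
    by (simp add: distrib_right sum.distrib)
  also have "f 0 + (\<Sum>i\<le>n. of_nat (n choose Suc i) * f (Suc i)) = (\<Sum>i\<le>Suc n. of_nat (n choose i) * f i)"
    by (subst sum.atMost_Suc_shift) simp
  also have "\<dots> = (\<Sum>i\<le>n. of_nat (n choose i) * f i)"
    by (simp add: binomial_eq_0)
  finally show ?thesis
    by (simp add: distrib_left sum.distrib)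
qed

text \<open>
  Dividing by \<open>pochhammer c n * pochhammer (a + b + c) n\<close> gives the usual evaluation of the
  balanced 3F2 series; without denominators no parameter has to be excluded.
  Induction on \<open>n\<close>: call the \<open>i\<close>-th summand \<open>C(n,i) F(n,i)\<close>. The sum for \<open>n + 1\<close> should be
  \<open>(a + c + n) (b + c + n)\<close> times the sum for \<open>n\<close>. After Pascal's rule the difference of the
  \<open>i\<close>-th summands is not zero, but Gosper's algorithm finds a \<open>G\<close> with value \<open>G(i + 1) - G(i)\<close> for it
  and with \<open>G(0) = G(n + 1) = 0\<close>.
\<close>

theorem pfaff_saalschuetz:
  fixes a b c :: "'a::comm_ring_1"
  shows "(\<Sum>i\<le>n. of_nat (n choose i) * (pochhammer a i * pochhammer b i * pochhammer c (n - i)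
            * pochhammer (a + b + c + of_nat i) (n - i)))
       = pochhammer (a + c) n * pochhammer (b + c) n"
proof (induction n)
  case 0
  show ?case by simp
next
  case (Suc n)
  define s where "s = a + b + c"
  define F where "F k i = pochhammer a i * pochhammer b i * pochhammer c (k - i)
                            * pochhammer (s + of_nat i) (k - i)" for k i
  define G where "G i = of_nat (i * (n choose i)) * (pochhammer a i * pochhammer b i
                          * pochhammer c (Suc n - i) * pochhammer (s + of_nat i) (n - i))" for i
  have telescope: "of_nat (n choose i) * (F (Suc n) i + F (Suc n) (Suc i))
      = (a + c + of_nat n) * (b + c + of_nat n) * (of_nat (n choose i) * F n i) + (G (Suc i) - G i)"
    if "i \<le> n" for i
  proof (cases "i = n")
    case True
    show ?thesis
      unfolding F_def G_def True by (simp add: binomial_eq_0 pochhammer_Suc s_def algebra_simps)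
  next
    case False
    then obtain k where n: "n = i + Suc k"
      using \<open>i \<le> n\<close> by (metis add_Suc_right le_neq_implies_less less_imp_Suc_add)
    have "Suc i * (n choose Suc i) = Suc k * (n choose i)"
      using binomial_absorption[of i n] binomial_absorb_comp[of n i] by (simp add: n)
    then have G_Suc: "G (Suc i) = (1 + of_nat k) * of_nat (n choose i) * (pochhammer a (Suc i)
        * pochhammer b (Suc i) * pochhammer c (Suc k) * pochhammer (s + of_nat i + 1) k)"
      unfolding G_def by (simp only: of_nat_mult[symmetric] of_nat_Suc[symmetric])
        (simp add: n algebra_simps)
    have lower: "pochhammer (s + of_nat i) (Suc k) = (s + of_nat i) * pochhammer (s + of_nat i + 1) k"
      by (rule pochhammer_rec)
    have upper: "pochhammer (s + of_nat i) (Suc (Suc k))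
        = (s + of_nat i) * pochhammer (s + of_nat i + 1) k * (s + of_nat i + 1 + of_nat k)"
      unfolding pochhammer_Suc[of _ "Suc k"] lower by (simp add: algebra_simps)
    have shifted: "pochhammer (s + of_nat (Suc i)) (Suc k)
        = pochhammer (s + of_nat i + 1) k * (s + of_nat i + 1 + of_nat k)"
      by (simp add: pochhammer_Suc add_ac)
    have diffs: "Suc n - i = Suc (Suc k)" "n - i = Suc k" "Suc n - Suc i = Suc k"
      by (simp_all add: n)
    have n': "of_nat n = of_nat i + of_nat k + (1::'a)"
      by (simp add: n)
    \<comment> \<open>All five terms are multiples of \<open>N A B C Q\<close>, which leaves a polynomial identity in
      \<open>a\<close>, \<open>b\<close>, \<open>c\<close>, \<open>I\<close> and \<open>K\<close>.\<close>
    define A where "A = pochhammer a i"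
    define B where "B = pochhammer b i"
    define C where "C = pochhammer c (Suc k)"
    define Q where "Q = pochhammer (s + of_nat i + 1) k"
    define N where "N = (of_nat (n choose i) :: 'a)"
    define I where "I = (of_nat i :: 'a)"
    define K where "K = (of_nat k :: 'a)"
    have F1: "F (Suc n) i = A * B * (C * (c + 1 + K)) * ((s + I) * Q * (s + I + 1 + K))"
      unfolding F_def diffs upper pochhammer_Suc[of c "Suc k"] A_def B_def C_def Q_def I_def K_def
      by (simp add: algebra_simps)
    have F2: "F (Suc n) (Suc i) = (A * (a + I)) * (B * (b + I)) * C * (Q * (s + I + 1 + K))"
      unfolding F_def diffs shifted pochhammer_Suc[of a] pochhammer_Suc[of b]
        A_def B_def C_def Q_def I_def K_def by simp
    have F3: "F n i = A * B * C * ((s + I) * Q)"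
      unfolding F_def diffs lower A_def B_def C_def Q_def I_def by simp
    have G1: "G (Suc i) = (1 + K) * N * ((A * (a + I)) * (B * (b + I)) * C * Q)"
      unfolding G_Suc pochhammer_Suc[of a] pochhammer_Suc[of b]
        A_def B_def C_def Q_def I_def K_def N_def by simp
    have G2: "G i = I * N * (A * B * (C * (c + 1 + K)) * ((s + I) * Q))"
      unfolding G_def diffs lower pochhammer_Suc[of c "Suc k"] A_def B_def C_def Q_def I_def K_def N_def
      by (simp add: algebra_simps)
    show ?thesis
      unfolding F1 F2 F3 G1 G2 n' N_def[symmetric] I_def[symmetric] K_def[symmetric] s_def
      by (simp add: algebra_simps)
  qed
  have "(\<Sum>i\<le>Suc n. of_nat (Suc n choose i) * F (Suc n) i)
      = (\<Sum>i\<le>n. of_nat (n choose i) * (F (Suc n) i + F (Suc n) (Suc i)))"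
    by (rule sum_binomial_Suc)
  also have "\<dots> = (\<Sum>i\<le>n. (a + c + of_nat n) * (b + c + of_nat n) * (of_nat (n choose i) * F n i)
                          + (G (Suc i) - G i))"
    by (intro sum.cong refl telescope) simp
  also have "\<dots> = (a + c + of_nat n) * (b + c + of_nat n) * (\<Sum>i\<le>n. of_nat (n choose i) * F n i)
                  + (G (Suc n) - G 0)"
    using sum_lessThan_telescope[of G "Suc n"]
    by (simp only: sum.distrib sum_distrib_left lessThan_Suc_atMost)
  also have "G (Suc n) - G 0 = 0"
    by (simp add: G_def binomial_eq_0)
  also have "(\<Sum>i\<le>n. of_nat (n choose i) * F n i) = pochhammer (a + c) n * pochhammer (b + c) n"
    using Suc.IH by (simp add: F_def s_def)
  finally show ?case
    by (simp add: F_def s_def pochhammer_Suc mult_ac)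
qed

section \<open>The identity behind the congruence\<close>

lemma fact_quotient_pochhammer:
  assumes "i \<le> p"
  shows "fact p / fact (p - i) = (- 1) ^ i * pochhammer (- of_nat p :: 'a::field_char_0) i"
proof -
  have "(fact p / (fact i * fact (p - i)) :: 'a) = (- 1) ^ i * pochhammer (- of_nat p) i / fact i"
    using assms by (simp add: gbinomial_pochhammer[symmetric] binomial_gbinomial[symmetric] binomial_fact)
  then show ?thesis
    by (simp add: field_simps)
qed

text \<open>
  The identity \<open>pfaff_saalschuetz\<close> at \<open>a = x - m + 1\<close>, \<open>b = - m\<close>, \<open>c = - x\<close>, where
  \<open>a + b + c = - (2 m - 1)\<close>. Since \<open>i \<le> n < m\<close>, none of the differences of
  natural numbers is truncated, so \<open>fact m / fact (m - i)\<close> is \<open>pochhammer b i\<close> up to sign, and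
  \<open>fact (2 * m - 1 - i)\<close> is \<open>pochhammer (a + b + c + i) (n - i)\<close> up to sign and the factor
  \<open>fact (2 * m - 1 - n)\<close>. All signs cancel.
\<close>

lemma balanced_binomial_sum:
  fixes x :: "'a::field_char_0"
  assumes "n < m"
  shows "(\<Sum>i\<le>n. ((x - of_nat m + of_nat i) gchoose i) * (x gchoose (n - i))
            * (fact m / fact (m - i)) * (fact (2 * m - 1 - i) / fact (2 * m - 1)) * (- 1) ^ i)
       = ((x + of_nat m) gchoose n) * (of_nat (m - 1) gchoose n) * inverse (of_nat (2 * m - 1) gchoose n)"
    (is "(\<Sum>i\<le>n. ?t i) = ?rhs")
proof -
  define a b c where "a = x - of_nat m + 1" and "b = - (of_nat m :: 'a)" and "c = - x"
  define r where "r = (fact (2 * m - 1 - n) / (fact n * fact (2 * m - 1)) :: 'a)"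
  have m: "of_nat (m - 1) = (of_nat m - 1 :: 'a)" "of_nat (2 * m - 1) = (2 * of_nat m - 1 :: 'a)"
    using assms by (simp_all add: of_nat_diff)
  have s: "a + b + c = - of_nat (2 * m - 1)"
    unfolding a_def b_def c_def m by simp
  have "?t i = r * (of_nat (n choose i) * (pochhammer a i * pochhammer b i * pochhammer c (n - i)
          * pochhammer (a + b + c + of_nat i) (n - i)))" if "i \<le> n" for i
  proof -
    have 1: "(x - of_nat m + of_nat i) gchoose i = pochhammer a i / fact i"
      by (simp add: gbinomial_pochhammer' a_def)
    have 2: "x gchoose (n - i) = (- 1) ^ (n - i) * pochhammer c (n - i) / fact (n - i)"
      by (simp add: gbinomial_pochhammer c_def)
    have 3: "fact m / fact (m - i) = (- 1) ^ i * pochhammer b i"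
      unfolding b_def using that assms by (intro fact_quotient_pochhammer) simp
    have le: "n - i \<le> 2 * m - 1 - i" and diff: "2 * m - 1 - i - (n - i) = 2 * m - 1 - n"
      using that assms by auto
    have shift: "- of_nat (2 * m - 1 - i) = a + b + c + of_nat i"
      unfolding s using that assms by (subst of_nat_diff) auto
    have "fact (2 * m - 1 - i) / fact (2 * m - 1 - n)
        = (- 1) ^ (n - i) * pochhammer (a + b + c + of_nat i) (n - i)"
      using fact_quotient_pochhammer[OF le, where 'a = 'a] unfolding diff shift .
    then have 4: "fact (2 * m - 1 - i) / fact (2 * m - 1) = (- 1) ^ (n - i)
        * pochhammer (a + b + c + of_nat i) (n - i) * fact (2 * m - 1 - n) / fact (2 * m - 1)"
      by (simp add: field_simps)
    have 5: "of_nat (n choose i) = (fact n / (fact i * fact (n - i)) :: 'a)"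
      using that by (rule binomial_fact)
    have sq: "(- 1) ^ k * ((- 1) ^ k * y) = y" for k and y :: 'a
      by (simp flip: mult.assoc power_mult_distrib)
    show ?thesis
      unfolding 1 2 3 4 5 r_def by (simp add: divide_simps mult_ac sq)
  qed
  then have "(\<Sum>i\<le>n. ?t i) = r * (pochhammer (a + c) n * pochhammer (b + c) n)"
    by (simp add: sum_distrib_left[symmetric] pfaff_saalschuetz)
  also have "pochhammer (a + c) n = (- 1) ^ n * fact n * (of_nat (m - 1) gchoose n)"
    unfolding gbinomial_pochhammer m a_def c_def by (simp flip: power_add mult_2)
  also have "pochhammer (b + c) n = (- 1) ^ n * fact n * ((x + of_nat m) gchoose n)"
    unfolding gbinomial_pochhammer b_def c_def by (simp add: add_ac flip: power_add mult_2)
  also have "r * ((- 1) ^ n * fact n * (of_nat (m - 1) gchoose n)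
              * ((- 1) ^ n * fact n * ((x + of_nat m) gchoose n))) = ?rhs"
  proof -
    have "(of_nat (2 * m - 1) gchoose n :: 'a) = fact (2 * m - 1) / (fact n * fact (2 * m - 1 - n))"
      unfolding binomial_gbinomial[symmetric] using assms by (intro binomial_fact) simp
    then have "inverse (of_nat (2 * m - 1) gchoose n :: 'a) = fact n * (fact n * r)"
      unfolding r_def by (simp only: inverse_eq_divide divide_divide_eq_right) simp
    moreover have "(- 1) ^ n * (- 1) ^ n = (1 :: 'a)"
      by (simp flip: power_mult_distrib)
    moreover have "r * (e * f * u * (e * f * v)) = v * u * (f * (f * r))" if "e * e = 1" for e f u v :: 'a
      using that by algebra
    ultimately show ?thesis
      by simp
  qed
  finally show ?thesis .
qed

text \<open>
  If the second factor is nonzero, then \<open>n - i \<le> x\<close>, so the upper argument \<open>x - m + i\<close> of the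
  first one is a natural number, and it is less than \<open>i\<close>. This settles the range \<open>n \<ge> m\<close>, in
  which the right side of the balanced sum is zero as well.
\<close>

lemma balanced_terms_vanish:
  assumes "x < m" and "m \<le> n" and "i \<le> n"
  shows "((of_nat x - of_nat m + of_nat i) gchoose i) * (of_nat x gchoose (n - i)) = (0 :: 'a::field_char_0)"
proof (cases "n - i \<le> x")
  case True
  with assms have "m \<le> x + i"
    by simp
  then have "of_nat x - of_nat m + of_nat i = (of_nat (x + i - m) :: 'a)"
    by (simp add: of_nat_diff)
  moreover have "x + i - m < i"
    using assms(1) \<open>m \<le> x + i\<close> by linarith
  ultimately show ?thesis
    by (simp flip: binomial_gbinomial)
next
  case False
  then show ?thesis
    by (simp flip: binomial_gbinomial)
qed

section \<open>The boundary case\<close>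

lemma central_binomial_step:
  "(k + 2) * (2 * k + 3 choose (k + 1)) = 2 * (2 * k + 3) * (2 * k + 1 choose k)"
proof -
  have 1: "Suc k * (2 * k + 3 choose (k + 1)) = (2 * k + 3) * (2 * k + 2 choose k)"
    using binomial_absorption[of k "2 * k + 3"] by simp
  have 2: "(k + 2) * (2 * k + 2 choose k) = Suc k * (2 * (2 * k + 1 choose k))"
    using binomial_absorb_comp[of "2 * k + 2" k] by simp
  have "Suc k * ((k + 2) * (2 * k + 3 choose (k + 1))) = (2 * k + 3) * ((k + 2) * (2 * k + 2 choose k))"
    by (subst mult.left_commute, subst 1) (simp only: mult_ac)
  also have "\<dots> = Suc k * (2 * (2 * k + 3) * (2 * k + 1 choose k))"
    by (subst 2) (simp only: mult_ac)
  finally have "Suc k * ((k + 2) * (2 * k + 3 choose (k + 1))) = Suc k * (2 * (2 * k + 3) * (2 * k + 1 choose k))" .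
  then show ?thesis
    by (simp only: mult_cancel1) simp
qed

text \<open>
  Each factor \<open>ab x (k + 3)\<close> extends both binomial coefficients in \<open>x\<close> by one factor; its
  constant \<open>4 (2 k + 3)\<^sup>2\<close> is, up to the factors \<open>k + 2\<close>, the square of the ratio in
  \<open>central_binomial_step\<close>.
\<close>

lemma lam_closed_form:
  "2 * of_nat (2 * k + 1 choose k) ^ 2 * lam (k + 2) x
     = (- 1) ^ (k + 1) * ((x + of_nat (k + 1)) gchoose (k + 1)) * (x gchoose (k + 1))"
proof (induction k)
  case 0
  show ?case
    by (simp add: lam_def ab_def algebra_simps)
next
  case (Suc k)
  define B B' where "B = (of_nat (2 * k + 1 choose k) :: rat)"
    and "B' = (of_nat (2 * Suc k + 1 choose Suc k) :: rat)"
  define p q where "p = (x + of_nat (k + 1)) gchoose (k + 1)" and "q = x gchoose (k + 1)"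
  define K where "K = (of_nat k :: rat)"
  define e where "e = (- 1 :: rat) ^ (k + 1)"
  have pos: "K + 2 \<noteq> 0" "2 * K + 3 \<noteq> 0"
    unfolding K_def by (simp_all add: add_nonneg_eq_0_iff)
  have "2 * Suc k + 1 = 2 * k + 3" and "Suc k = k + 1"
    by simp_all
  then have "B' = of_nat (2 * k + 3 choose (k + 1))"
    unfolding B'_def by metis
  with central_binomial_step[of k, THEN arg_cong, of "of_nat :: nat \<Rightarrow> rat"]
  have B': "(K + 2) * B' = 2 * (2 * K + 3) * B"
    by (simp only: B_def K_def of_nat_mult of_nat_add of_nat_numeral)
  have "{2..Suc k + 2} = insert (k + 3) {2..k + 2}"
    by auto
  then have lam: "4 * (2 * K + 3) ^ 2 * lam (Suc k + 2) x
      = - ((x - K - 1) * (x + K + 2)) * lam (k + 2) x"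
    using pos by (simp add: lam_def ab_def K_def field_simps)
  have p': "(K + 2) * ((x + of_nat (Suc k + 1)) gchoose (Suc k + 1)) = (x + K + 2) * p"
  proof -
    have "x + of_nat (Suc k + 1) - 1 = x + of_nat (k + 1)"
      by simp
    then show ?thesis
      using gbinomial_absorption[of "k + 1" "x + of_nat (Suc k + 1)"]
      by (simp add: p_def K_def add_ac)
  qed
  have q': "(K + 2) * (x gchoose (Suc k + 1)) = (x - K - 1) * q"
    using gbinomial_absorb_comp[of x "k + 1"] gbinomial_absorption[of "k + 1" x]
    by (simp add: q_def K_def algebra_simps)
  have IH: "2 * B ^ 2 * lam (k + 2) x = e * p * q"
    using Suc.IH by (simp add: B_def p_def q_def e_def)
  have "(K + 2) ^ 2 * (2 * B' ^ 2 * lam (Suc k + 2) x)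
      = 2 * ((K + 2) * B') ^ 2 * lam (Suc k + 2) x"
    by (simp add: power_mult_distrib)
  also have "\<dots> = 2 * B ^ 2 * (4 * (2 * K + 3) ^ 2 * lam (Suc k + 2) x)"
    unfolding B' by algebra
  also have "\<dots> = - ((x - K - 1) * (x + K + 2)) * (2 * B ^ 2 * lam (k + 2) x)"
    unfolding lam by simp
  also have "\<dots> = - e * ((x + K + 2) * p) * ((x - K - 1) * q)"
    unfolding IH by simp
  also have "\<dots> = (K + 2) ^ 2 * (- e * ((x + of_nat (Suc k + 1)) gchoose (Suc k + 1)) * (x gchoose (Suc k + 1)))"
    unfolding p'[symmetric] q'[symmetric] by (simp add: power2_eq_square)
  finally show ?case
    using pos by (simp add: B'_def e_def)
qed

text \<open>
  At \<open>x = k + 2\<close> the numerator of the closed form is itself a multiple of the central coefficient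
  \<open>2 k + 1\<close> over \<open>k\<close>, so that only its first power is left in the denominator.
\<close>

lemma lam_diagonal:
  "of_nat (2 * k + 1 choose k) * lam (k + 2) (of_nat (k + 2)) = (- 1) ^ (k + 1) * of_nat (2 * k + 3)"
proof -
  define B where "B = (of_nat (2 * k + 1 choose k) :: rat)"
  have "B \<noteq> 0"
    by (simp add: B_def)
  have "k + 2 + (k + 1) = 2 * k + 3"
    by simp
  then have upper: "(of_nat (k + 2) + of_nat (k + 1) :: rat) gchoose (k + 1)
      = of_nat (2 * k + 3 choose (k + 1))"
    by (metis of_nat_add binomial_gbinomial)
  have "2 * B ^ 2 * lam (k + 2) (of_nat (k + 2))
      = (- 1) ^ (k + 1) * of_nat ((2 * k + 3 choose (k + 1)) * (k + 2 choose (k + 1)))"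
    using lam_closed_form[of k "of_nat (k + 2)"]
    unfolding upper binomial_gbinomial[symmetric] B_def of_nat_mult by (simp only: mult.assoc)
  also have "(2 * k + 3 choose (k + 1)) * (k + 2 choose (k + 1)) = 2 * (2 * k + 3) * (2 * k + 1 choose k)"
  proof -
    have "k + 2 choose (k + 1) = k + 2"
      using binomial_symmetric[of 1 "k + 2"] by simp
    then show ?thesis
      using central_binomial_step[of k] by (simp only: mult.commute)
  qed
  finally have "2 * B * (B * lam (k + 2) (of_nat (k + 2))) = 2 * B * ((- 1) ^ (k + 1) * of_nat (2 * k + 3))"
    by (simp add: B_def power2_eq_square mult_ac)
  moreover have "2 * B \<noteq> 0"
    using \<open>B \<noteq> 0\<close> by simp
  ultimately show ?thesis
    unfolding B_def[symmetric] using mult_left_cancel by blast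
qed

text \<open>
  By \<open>lam_diagonal\<close> an integer value \<open>l\<close> divides \<open>2 m - 1\<close>, which is coprime to \<open>m\<close>.
\<close>

lemma lam_diagonal_not_multiple:
  assumes "2 \<le> m" and "lam m (of_nat m) = of_int l"
  shows "\<not> int m dvd l"
proof
  assume dvd: "int m dvd l"
  obtain k where m: "m = k + 2"
    using assms(1) by (metis le_add_diff_inverse2)
  have "(of_int (int (2 * k + 1 choose k) * l) :: rat) = of_int ((- 1) ^ (k + 1) * int (2 * k + 3))"
    using lam_diagonal[of k] assms(2) unfolding m by simp
  then have "int (2 * k + 1 choose k) * l = (- 1) ^ (k + 1) * int (2 * k + 3)"
    by (simp only: of_int_eq_iff)
  moreover have "int m dvd int (2 * k + 1 choose k) * l"
    using dvd by simp
  ultimately have "int m dvd (- 1) ^ (k + 1) * int (2 * k + 3)"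
    by simp
  then have "int m dvd int (2 * k + 3)"
    by (simp add: dvd_mult_unit_iff')
  then have "int m dvd 2 * int m - int (2 * k + 3)"
    by simp
  then have "int m dvd 1"
    by (simp add: m)
  with assms(1) show False
    by simp
qed

section \<open>The congruence\<close>

theorem corollary3p4:
  fixes h m n :: nat and x l :: int
  assumes "2 \<le> h" and "h \<le> m" and "0 \<le> x" and "x \<le> int h"
    and "lam m (of_int x) = of_int l" and "int h dvd l"
  shows "rat_cong
    ((of_int x :: rat) gchoose n)
    ((\<Sum>i = 1..n.
        if i \<le> m then
          ((of_int x - of_nat m + of_nat i) gchoose i) * (of_int x gchoose (n - i))
          * (fact m / fact (m - i)) * (fact (2 * m - 1 - i) / fact (2 * m - 1)) * (- 1) ^ (i + 1)
        else 0)
     + (if n < m then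
          ((of_int x + of_nat m) gchoose n) * (of_nat (m - 1) gchoose n)
          * inverse (of_nat (2 * m - 1) gchoose n)
        else 0))
    h"
proof -
  \<comment> \<open>Since \<open>x \<le> h \<le> m\<close>, the value \<open>x = m\<close> would force \<open>h = m\<close>.\<close>
  have "x \<noteq> int m"
  proof
    assume "x = int m"
    with assms have "h = m"
      by simp
    with assms lam_diagonal_not_multiple[of m l] \<open>x = int m\<close> show False
      by simp
  qed
  with assms obtain y where x: "x = int y" and "y < m"
    by (metis nonneg_int_cases of_nat_le_iff of_nat_less_iff order_trans order_le_less)
  define t :: "nat \<Rightarrow> rat" where
    "t i = ((of_int x - of_nat m + of_nat i) gchoose i) * (of_int x gchoose (n - i))
      * (fact m / fact (m - i)) * (fact (2 * m - 1 - i) / fact (2 * m - 1)) * (- 1) ^ i" for i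
  define R :: rat where "R = (if n < m then ((of_int x + of_nat m) gchoose n)
      * (of_nat (m - 1) gchoose n) * inverse (of_nat (2 * m - 1) gchoose n) else 0)"
  have zero: "t i = 0" if "m \<le> n" "i \<le> n" for i
    using balanced_terms_vanish[OF \<open>y < m\<close> that, where 'a = rat] by (simp add: t_def x)
  have "(\<Sum>i\<le>n. t i) = R"
  proof (cases "n < m")
    case True
    then show ?thesis
      unfolding t_def R_def by (simp only: balanced_binomial_sum if_True)
  next
    case False
    then show ?thesis
      by (simp add: zero R_def)
  qed
  moreover have "(\<Sum>i\<le>n. t i) = t 0 + (\<Sum>i = 1..n. t i)"
    by (simp add: atMost_atLeast0 sum.atLeast_Suc_atMost)
  moreover have "t 0 = of_int x gchoose n"
    by (simp add: t_def)
  moreover have cut: "(\<Sum>i = 1..n.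
        if i \<le> m then
          ((of_int x - of_nat m + of_nat i) gchoose i) * (of_int x gchoose (n - i))
          * (fact m / fact (m - i)) * (fact (2 * m - 1 - i) / fact (2 * m - 1)) * (- 1) ^ (i + 1)
        else 0) = (\<Sum>i = 1..n. - t i)"
  proof (intro sum.cong refl, goal_cases)
    case (1 i)
    \<comment> \<open>The cut-off at \<open>i \<le> m\<close> can only drop terms when \<open>n > m\<close>, and these are zero.\<close>
    then show ?case
      using zero[of i] by (auto simp: t_def)
  qed
  ultimately have "of_int x gchoose n = (\<Sum>i = 1..n. - t i) + R"
    by (simp add: sum_negf)
  then show ?thesis
    unfolding rat_cong_def R_def[symmetric] cut by simp
qed

end
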